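(* For all integers $i,j,n\ge 0$, $$t^i\smile_n t^j=\binom{i}{n}\binom{j}{n}\,t^{i+j-n}\in N^*(B\Sigma_2),$$ where the binomial coefficients are taken mod $2$.
   Context: All chains and cochains have $\mathbb{F}_2$ coefficients. For a simplicial set $X$, $N_*(X)$ is the normalized chain complex: $N_k(X)$ is the $\mathbb{F}_2$-vector space on $X_k$ modulo the span of degenerate simplices, with boundary the sum of the codimension one faces. $N^*(X)$ is the dual cochain complex; cochains are graded here in non-negative degrees. For a group $G$, $EG$ is the simplicial set with $(EG)_k=G^{k+1}$, faces deleting entries, degeneracies repeating entries, with left $G$-action $g(g_0,\dots,g_k)=(gg_0,\dots,gg_k)$, and $BG=G\backslash EG$. For $\Sigma_2=\{1,T\}$, $B\Sigma_2$ has exactly one non-degenerate simplex $x_k$ in each dimension $k\ge 0$, the image of $\tilde x_k=(1,T,1,\dots,T^k)\in (E\Sigma_2)_k$. Write $t^k\in N^k(B\Sigma_2)$ for the cochain dual to $x_k$ (it is also the $k$-th cup power of $t=t^1$). Steenrod's $\smile_n$ products: for $\alpha\in N^i(X)$, $\beta\in N^j(X)$ and a simplex $u:\Delta^N\to X$ with $N=i+j-n$, $$\langle\alpha\smile_n\beta,u\rangle=\sum_{0\le k_1<k_2<\cdots<k_{n+1}\le N}\langle\alpha,u(I_{odd})\rangle\,\langle\beta,u(I_{even})\rangle ,$$ where $I_1=\{0,\dots,k_1\}$, $I_m=\{k_{m-1},\dots,k_m\}$ for $2\le m\le n+1$, $I_{n+2}=\{k_{n+1},\dots,N\}$, $I_{odd}=\bigcup_{m\text{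 odd}}I_m$, $I_{even}=\bigcup_{m\text{ even}}I_m$ (over $1\le m\le n+2$), $u(I)$ denotes the face of $u$ spanned by the vertex set $I$, and the evaluation of a cochain on a face of a different degree is $0$. If $i+j-n<0$ the product is $0$. Convention: $\binom{A}{B}=0$ unless $0\le B\le A$. *)

theory Defs
  imports
    "HOL-Algebra.Sym_Groups"
    "HOL-Library.Poly_Mapping"
    "HOL-Library.Z2"
begin

section \<open>Simplicial sets\<close>

text \<open>
  \<open>face X k i\<close> is the operator \<open>d\<^sub>i : X\<^sub>k \<rightarrow> X\<^sub>k\<^sub>-\<^sub>1\<close> and
  \<open>degen X k i\<close> is the operator \<open>s\<^sub>i : X\<^sub>k \<rightarrow> X\<^sub>k\<^sub>+\<^sub>1\<close>; the dimension of the argument is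
  explicit because the sets \<open>X\<^sub>k\<close> need not be disjoint.
\<close>

record 'a sset =
  simplices :: "nat \<Rightarrow> 'a set"
  face :: "nat \<Rightarrow> nat \<Rightarrow> 'a \<Rightarrow> 'a"
  degen :: "nat \<Rightarrow> nat \<Rightarrow> 'a \<Rightarrow> 'a"

locale simplicial_set =
  fixes X :: "'a sset"
  assumes face_closed:
      "\<lbrakk>u \<in> simplices X (Suc k); i \<le> Suc k\<rbrakk> \<Longrightarrow> face X (Suc k) i u \<in> simplices X k"
    and degen_closed:
      "\<lbrakk>u \<in> simplices X k; i \<le> k\<rbrakk> \<Longrightarrow> degen X k i u \<in> simplices X (Suc k)"
    and face_face:
      "\<lbrakk>u \<in> simplices X (Suc (Suc k)); i < j; j \<le> Suc (Suc k)\<rbrakk> \<Longrightarrow>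
        face X (Suc k) i (face X (Suc (Suc k)) j u)
          = face X (Suc k) (j - 1) (face X (Suc (Suc k)) i u)"
    and face_degen_less:
      "\<lbrakk>u \<in> simplices X (Suc k); i < j; j \<le> Suc k\<rbrakk> \<Longrightarrow>
        face X (Suc (Suc k)) i (degen X (Suc k) j u)
          = degen X k (j - 1) (face X (Suc k) i u)"
    and face_degen_same:
      "\<lbrakk>u \<in> simplices X k; j \<le> k; i = j \<or> i = Suc j\<rbrakk> \<Longrightarrow>
        face X (Suc k) i (degen X k j u) = u"
    and face_degen_greater:
      "\<lbrakk>u \<in> simplices X (Suc k); Suc j < i; i \<le> Suc (Suc k)\<rbrakk> \<Longrightarrow>
        face X (Suc (Suc k)) i (degen X (Suc k) j u)
          = degen X k j (face X (Suc k) (i - 1) u)"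
    and degen_degen:
      "\<lbrakk>u \<in> simplices X k; i \<le> j; j \<le> k\<rbrakk> \<Longrightarrow>
        degen X (Suc k) i (degen X k j u) = degen X (Suc k) (Suc j) (degen X k i u)"

definition degenerate_simplices :: "'a sset \<Rightarrow> nat \<Rightarrow> 'a set" where
  "degenerate_simplices X k =
     {degen X l i v | l i v. k = Suc l \<and> i \<le> l \<and> v \<in> simplices X l}"

definition nondegenerate_simplices :: "'a sset \<Rightarrow> nat \<Rightarrow> 'a set" where
  "nondegenerate_simplices X k = simplices X k - degenerate_simplices X k"

fun delete_vertices :: "'a sset \<Rightarrow> nat \<Rightarrow> nat list \<Rightarrow> 'a \<Rightarrow> 'a" where
  "delete_vertices X k [] u = u"
| "delete_vertices X k (i # is) u = delete_vertices X (k - 1) is (face X k i u)"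

text \<open>
  The face \<open>u(I)\<close> of a \<open>k\<close>-simplex \<open>u\<close> spanned by the vertices in \<open>I \<subseteq> {0..k}\<close>. The other
  vertices are deleted in decreasing order, so that the positions of the ones still to be
  deleted do not shift. The result has dimension \<open>card I - 1\<close>.
\<close>

definition spanned_face :: "'a sset \<Rightarrow> nat \<Rightarrow> nat set \<Rightarrow> 'a \<Rightarrow> 'a" where
  "spanned_face X k I u = delete_vertices X k (rev (sorted_list_of_set ({..k} - I))) u"


section \<open>Normalized chains and cochains\<close>

text \<open>
  \<open>N\<^sub>k(X)\<close> is the quotient of the \<open>\<bbbF>\<^sub>2\<close>-vector space \<open>simplicial_chains X k\<close> on \<open>X\<^sub>k\<close> by the
  span of the degenerate simplices, i.e. by the chains supported on degenerate simplices.
  Over \<open>\<bbbF>\<^sub>2\<close> linear means additive.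
\<close>

definition simplicial_chains :: "'a sset \<Rightarrow> nat \<Rightarrow> ('a \<Rightarrow>\<^sub>0 bit) set" where
  "simplicial_chains X k = {c. Poly_Mapping.keys c \<subseteq> simplices X k}"

definition normalization_rel :: "'a sset \<Rightarrow> nat \<Rightarrow> (('a \<Rightarrow>\<^sub>0 bit) \<times> ('a \<Rightarrow>\<^sub>0 bit)) set" where
  "normalization_rel X k =
     {(a, b). a \<in> simplicial_chains X k \<and> b \<in> simplicial_chains X k \<and>
              Poly_Mapping.keys (a - b) \<subseteq> degenerate_simplices X k}"

abbreviation chain_class :: "'a sset \<Rightarrow> nat \<Rightarrow> ('a \<Rightarrow>\<^sub>0 bit) \<Rightarrow> ('a \<Rightarrow>\<^sub>0 bit) set" where
  "chain_class X k c \<equiv> normalization_rel X k `` {c}"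

definition normalized_chains :: "'a sset \<Rightarrow> nat \<Rightarrow> ('a \<Rightarrow>\<^sub>0 bit) set set" where
  "normalized_chains X k = simplicial_chains X k // normalization_rel X k"

definition normalized_chains_dual :: "'a sset \<Rightarrow> nat \<Rightarrow> (('a \<Rightarrow>\<^sub>0 bit) set \<Rightarrow> bit) set" where
  "normalized_chains_dual X k =
     {\<phi> \<in> extensional (normalized_chains X k).
        \<forall>a\<in>simplicial_chains X k. \<forall>b\<in>simplicial_chains X k.
          \<phi> (chain_class X k (a + b)) = \<phi> (chain_class X k a) + \<phi> (chain_class X k b)}"

text \<open>
  An element of \<open>N\<^sup>k(X)\<close> is represented by its values \<open>\<langle>\<alpha>,u\<rangle>\<close> on the \<open>k\<close>-simplices \<open>u\<close>, which
  vanish on degenerate simplices (and, by convention, off \<open>X\<^sub>k\<close>). The theorem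
  \<open>bij_betw_dual_cochains\<close> below identifies this with the dual of \<open>N\<^sub>k(X)\<close>.
\<close>

definition cochains :: "'a sset \<Rightarrow> nat \<Rightarrow> ('a \<Rightarrow> bit) set" where
  "cochains X k =
     {\<alpha>. (\<forall>u. u \<notin> simplices X k \<longrightarrow> \<alpha> u = 0) \<and> (\<forall>u\<in>degenerate_simplices X k. \<alpha> u = 0)}"

text \<open>
  For a non-degenerate simplex \<open>x\<close>, the element of the dual basis belonging to \<open>x\<close>, with respect
  to the basis of \<open>N\<^sub>k(X)\<close> given by the non-degenerate \<open>k\<close>-simplices.
\<close>

definition dual_cochain :: "'a \<Rightarrow> 'a \<Rightarrow> bit" where
  "dual_cochain x = (\<lambda>u. if u = x then 1 else 0)"


section \<open>Steenrod's products\<close>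

text \<open>
  For \<open>ks = [k\<^sub>1, \<dots>, k\<^sub>n\<^sub>+\<^sub>1]\<close> and \<open>1 \<le> m \<le> n + 2\<close>, \<open>steenrod_interval N ks m\<close> is \<open>I\<^sub>m\<close>, with the
  conventions \<open>k\<^sub>0 = 0\<close> and \<open>k\<^sub>n\<^sub>+\<^sub>2 = N\<close>.
\<close>

definition steenrod_interval :: "nat \<Rightarrow> nat list \<Rightarrow> nat \<Rightarrow> nat set" where
  "steenrod_interval N ks m = {(0 # ks @ [N]) ! (m - 1) .. (0 # ks @ [N]) ! m}"

definition steenrod_odd :: "nat \<Rightarrow> nat list \<Rightarrow> nat set" where
  "steenrod_odd N ks =
     (\<Union>m \<in> {m. 1 \<le> m \<and> m \<le> length ks + 1 \<and> odd m}. steenrod_interval N ks m)"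

definition steenrod_even :: "nat \<Rightarrow> nat list \<Rightarrow> nat set" where
  "steenrod_even N ks =
     (\<Union>m \<in> {m. 1 \<le> m \<and> m \<le> length ks + 1 \<and> even m}. steenrod_interval N ks m)"

text \<open>The value of a degree \<open>i\<close> cochain on \<open>u(I)\<close>, which is 0 unless \<open>u(I)\<close> has dimension \<open>i\<close>.\<close>

definition eval_face ::
    "'a sset \<Rightarrow> nat \<Rightarrow> ('a \<Rightarrow> bit) \<Rightarrow> nat \<Rightarrow> 'a \<Rightarrow> nat set \<Rightarrow> bit" where
  "eval_face X i \<alpha> N u I = (if card I = Suc i then \<alpha> (spanned_face X N I u) else 0)"

text \<open>
  \<open>steenrod_product X n i j \<alpha> \<beta>\<close> is \<open>\<alpha> \<smile>\<^sub>n \<beta>\<close> for \<open>\<alpha> \<in> N\<^sup>i(X)\<close> and \<open>\<beta> \<in> N\<^sup>j(X)\<close>; the degrees are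
  explicit because they cannot be read off from \<open>\<alpha>\<close> and \<open>\<beta>\<close>. If \<open>i + j < n\<close> the product is 0,
  and the truncated difference \<open>i + j - n\<close> is not used.
\<close>

definition steenrod_product ::
    "'a sset \<Rightarrow> nat \<Rightarrow> nat \<Rightarrow> nat \<Rightarrow> ('a \<Rightarrow> bit) \<Rightarrow> ('a \<Rightarrow> bit) \<Rightarrow> 'a \<Rightarrow> bit" where
  "steenrod_product X n i j \<alpha> \<beta> =
     (\<lambda>u. if n \<le> i + j \<and> u \<in> simplices X (i + j - n)
          then \<Sum>ks \<in> {ks. length ks = n + 1 \<and> sorted_wrt (<) ks \<and> set ks \<subseteq> {0..i + j - n}}.
                 eval_face X i \<alpha> (i + j - n) u (steenrod_odd (i + j - n) ks) *
                 eval_face X j \<beta> (i + j - n) u (steenrod_even (i + j - n) ks)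
          else 0)"


section \<open>The simplicial sets \<open>EG\<close> and \<open>BG\<close>\<close>

definition EG :: "('g, 'm) monoid_scheme \<Rightarrow> 'g list sset" where
  "EG G = \<lparr>simplices = (\<lambda>k. {gs. length gs = Suc k \<and> set gs \<subseteq> carrier G}),
           face = (\<lambda>k i gs. take i gs @ drop (Suc i) gs),
           degen = (\<lambda>k i gs. take (Suc i) gs @ drop i gs)\<rparr>"

definition EG_act :: "('g, 'm) monoid_scheme \<Rightarrow> 'g \<Rightarrow> 'g list \<Rightarrow> 'g list" where
  "EG_act G g gs = map (\<lambda>x. g \<otimes>\<^bsub>G\<^esub> x) gs"

definition EG_orbit :: "('g, 'm) monoid_scheme \<Rightarrow> 'g list \<Rightarrow> 'g list set" where
  "EG_orbit G gs = (\<lambda>g. EG_act G g gs) ` carrier G"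

text \<open>
  The simplices of \<open>BG\<close> are the \<open>G\<close>-orbits in \<open>EG\<close>. The operators of \<open>EG\<close> commute with the action,
  so the image of an orbit is an orbit.
\<close>

definition BG :: "('g, 'm) monoid_scheme \<Rightarrow> 'g list set sset" where
  "BG G = \<lparr>simplices = (\<lambda>k. EG_orbit G ` simplices (EG G) k),
           face = (\<lambda>k i c. face (EG G) k i ` c),
           degen = (\<lambda>k i c. degen (EG G) k i ` c)\<rparr>"


section \<open>The cochains \<open>t\<^sup>k\<close> on \<open>B\<Sigma>\<^sub>2\<close>\<close>

abbreviation Sigma2 :: "(nat \<Rightarrow> nat) monoid" where
  "Sigma2 \<equiv> sym_group 2"

definition T :: "nat \<Rightarrow> nat" where
  "T = transpose 1 2"

definition x_tilde :: "nat \<Rightarrow> (nat \<Rightarrow> nat) list" where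
  "x_tilde k = map (\<lambda>m. T [^]\<^bsub>Sigma2\<^esub> m) [0..<Suc k]"

definition x_simplex :: "nat \<Rightarrow> (nat \<Rightarrow> nat) list set" where
  "x_simplex k = EG_orbit Sigma2 (x_tilde k)"

definition t_cochain :: "nat \<Rightarrow> (nat \<Rightarrow> nat) list set \<Rightarrow> bit" where
  "t_cochain k = dual_cochain (x_simplex k)"


section \<open>Consistency of the definitions\<close>

subsection \<open>\<open>EG\<close> and \<open>BG\<close> are simplicial sets\<close>

lemma EG_simps [simp]:
  "gs \<in> simplices (EG G) k \<longleftrightarrow> length gs = Suc k \<and> set gs \<subseteq> carrier G"
  "face (EG G) k i gs = take i gs @ drop (Suc i) gs"
  "degen (EG G) k i gs = take (Suc i) gs @ drop i gs"
  by (simp_all add: EG_def)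

lemma simplicial_set_EG: "simplicial_set (EG G)"
proof
  fix u :: "'a list" and k i
  assume "u \<in> simplices (EG G) (Suc k)" "i \<le> Suc k"
  then show "face (EG G) (Suc k) i u \<in> simplices (EG G) k"
    by (auto dest: in_set_takeD in_set_dropD)
next
  fix u :: "'a list" and k i
  assume "u \<in> simplices (EG G) k" "i \<le> k"
  then show "degen (EG G) k i u \<in> simplices (EG G) (Suc k)"
    by (auto dest: in_set_takeD in_set_dropD)
next
  fix u :: "'a list" and k i j
  assume "u \<in> simplices (EG G) k" "i \<le> j" "j \<le> k"
  then show "degen (EG G) (Suc k) i (degen (EG G) k j u)
      = degen (EG G) (Suc k) (Suc j) (degen (EG G) k i u)"
    by (cases "i = j") (auto intro!: nth_equalityI simp: nth_append min_def split: if_splits)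
qed (auto intro!: nth_equalityI simp: nth_append min_def split: if_splits)

lemma BG_simps:
  "simplices (BG G) k = EG_orbit G ` simplices (EG G) k"
  "face (BG G) k i (EG_orbit G gs) = EG_orbit G (face (EG G) k i gs)"
  "degen (BG G) k i (EG_orbit G gs) = EG_orbit G (degen (EG G) k i gs)"
  by (simp_all add: BG_def EG_orbit_def EG_act_def image_image take_map drop_map)

lemma simplicial_set_BG: "simplicial_set (BG G)"
proof -
  interpret E: simplicial_set "EG G" by (rule simplicial_set_EG)
  show ?thesis
  proof
  qed (unfold BG_simps(1), (elim imageE, simp only: BG_simps,
        (intro imageI E.face_closed E.degen_closed | intro arg_cong[where f = "EG_orbit G"]
          E.face_face E.face_degen_less E.face_degen_same E.face_degen_greater E.degen_degen);
        assumption)+)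
qed


subsection \<open>\<open>u(I)\<close> in \<open>EG\<close>\<close>

lemma delete_vertices_EG:
  assumes "sorted_wrt (>) js" "set js \<subseteq> {..<length gs}"
  shows "delete_vertices (EG G) k js gs = nths gs (- set js)"
  using assms
proof (induction js arbitrary: k gs)
  case Nil
  then show ?case by (simp add: nths_all)
next
  case (Cons j js)
  have lt: "\<forall>i\<in>set js. i < j" and j: "j < length gs" using Cons.prems by auto
  have split: "gs = take j gs @ gs ! j # drop (Suc j) gs"
    using j by (simp add: id_take_nth_drop)
  have sub: "set js \<subseteq> {..<length (take j gs @ drop (Suc j) gs)}"
    using lt j by auto
  have tail: "{m. m + j \<in> - set js} = UNIV" "{m. Suc (m + j) \<in> - set (j # js)} = UNIV"
    using lt by fastforce+
  have "delete_vertices (EG G) k (j # js) gs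
      = nths (take j gs @ drop (Suc j) gs) (- set js)"
    using Cons.IH[of "take j gs @ drop (Suc j) gs" "k - 1"] Cons.prems(1) sub by simp
  also have "\<dots> = nths (take j gs) (- set js) @ drop (Suc j) gs"
    using j tail by (simp add: nths_append nths_all)
  also have "nths (take j gs) (- set js) = nths (take j gs) (- set (j # js))"
    by (auto simp: nths_def intro!: arg_cong[where f = "map fst"] filter_cong dest: set_zip_rightD)
  also have "nths (take j gs) (- set (j # js)) @ drop (Suc j) gs
      = nths (take j gs @ gs ! j # drop (Suc j) gs) (- set (j # js))"
    using j tail(2) by (simp add: nths_append nths_Cons nths_all)
  finally show ?case using split by simp
qed

lemma spanned_face_EG:
  assumes "gs \<in> simplices (EG G) k" "I \<subseteq> {..k}"
  shows "spanned_face (EG G) k I gs = nths gs I"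
proof -
  have "sorted_wrt (>) (rev (sorted_list_of_set ({..k} - I)))"
    by (simp add: sorted_wrt_rev)
  then have "spanned_face (EG G) k I gs = nths gs (- ({..k} - I))"
    using assms unfolding spanned_face_def by (subst delete_vertices_EG) auto
  also have "\<dots> = nths gs I"
    using assms by (auto simp: nths_def intro!: arg_cong[where f = "map fst"] filter_cong
        dest!: set_zip_rightD)
  finally show ?thesis .
qed

lemma delete_vertices_BG:
  "delete_vertices (BG G) k js (EG_orbit G gs) = EG_orbit G (delete_vertices (EG G) k js gs)"
  by (induction js arbitrary: k gs) (simp_all add: BG_simps del: EG_simps)

lemma spanned_face_BG:
  assumes "gs \<in> simplices (EG G) k" "I \<subseteq> {..k}"
  shows "spanned_face (BG G) k I (EG_orbit G gs) = EG_orbit G (nths gs I)"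
  using spanned_face_EG[OF assms] by (simp add: spanned_face_def delete_vertices_BG)


subsection \<open>Steenrod's products of normalized cochains are normalized\<close>

context simplicial_set
begin

lemma degenerate_simplices_subset: "degenerate_simplices X k \<subseteq> simplices X k"
  by (auto simp: degenerate_simplices_def intro: degen_closed)

lemma delete_vertices_degen:
  assumes "v \<in> simplices X l" "p \<le> l" "sorted_wrt (>) js" "set js \<subseteq> {..Suc l} - {p, Suc p}"
  shows "delete_vertices X (Suc l) js (degen X l p v) \<in> degenerate_simplices X (Suc l - length js)"
  using assms
proof (induction js arbitrary: l p v)
  case Nil
  then show ?case by (auto simp: degenerate_simplices_def)
next
  case (Cons j js)
  have j: "j \<le> Suc l" "j \<noteq> p" "j \<noteq> Suc p" and lt: "\<forall>i\<in>set js. i < j"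
    using Cons.prems by auto
  obtain l' where l: "l = Suc l'" using j Cons.prems(2) by (cases l) auto
  consider "j < p" | "Suc p < j" using j by linarith
  then show ?case
  proof cases
    case 1
    have "delete_vertices X (Suc l') js (degen X l' (p - 1) (face X (Suc l') j v))
        \<in> degenerate_simplices X (Suc l' - length js)"
      using Cons.prems 1 l lt by (intro Cons.IH face_closed) fastforce+
    with 1 Cons.prems l show ?thesis by (simp add: face_degen_less)
  next
    case 2
    have "delete_vertices X (Suc l') js (degen X l' p (face X (Suc l') (j - 1) v))
        \<in> degenerate_simplices X (Suc l' - length js)"
      using Cons.prems 2 l lt j by (intro Cons.IH face_closed) fastforce+
    with 2 Cons.prems l j show ?thesis by (simp add: face_degen_greater)
  qed
qed

lemma eval_face_degen:
  assumes "\<alpha> \<in> cochains X i" "v \<in> simplices X l" "p \<le> l" "I \<subseteq> {..Suc l}" "p \<in> I" "Suc p \<in> I"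
  shows "eval_face X i \<alpha> (Suc l) (degen X l p v) I = 0"
proof (cases "card I = Suc i")
  case True
  have "card ({..Suc l} - I) = Suc (Suc l) - Suc i"
    using assms(4) True by (simp add: card_Diff_subset finite_subset)
  moreover have "Suc i \<le> Suc (Suc l)"
    using card_mono[OF _ assms(4)] True by simp
  ultimately have i: "Suc l - length (rev (sorted_list_of_set ({..Suc l} - I))) = i"
    by simp
  have "spanned_face X (Suc l) I (degen X l p v) \<in> degenerate_simplices X i"
    using delete_vertices_degen[of v l p "rev (sorted_list_of_set ({..Suc l} - I))"] assms
    unfolding spanned_face_def i by (auto simp: sorted_wrt_rev)
  with assms(1) show ?thesis by (simp add: eval_face_def cochains_def)
qed (simp add: eval_face_def)

end

lemma steenrod_interval_subset:
  assumes "set ks \<subseteq> {..N}" "m \<le> length ks + 1"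
  shows "steenrod_interval N ks m \<subseteq> {..N}"
proof -
  have "(0 # ks @ [N]) ! m \<in> set (0 # ks @ [N])"
    using assms(2) by (intro nth_mem) simp
  with assms(1) show ?thesis by (auto simp: steenrod_interval_def)
qed

lemma edge_in_steenrod_interval:
  assumes "p < N"
  shows "\<exists>m. 1 \<le> m \<and> m \<le> length ks + 1 \<and> {p, Suc p} \<subseteq> steenrod_interval N ks m"
proof -
  define K where "K = 0 # ks @ [N]"
  define m where "m = (LEAST m. p < K ! m)"
  have last: "p < K ! (length ks + 1)" using assms by (simp add: K_def nth_append)
  then have m: "p < K ! m" "m \<le> length ks + 1"
    unfolding m_def by (fact LeastI, fact Least_le)
  then have pos: "1 \<le> m" by (cases m) (auto simp: K_def)
  then have "\<not> p < K ! (m - 1)" unfolding m_def by (intro not_less_Least) (simp flip: m_def)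
  with m pos show ?thesis by (auto simp: steenrod_interval_def K_def intro!: exI[of _ m])
qed

lemma (in simplicial_set) steenrod_product_in_cochains:
  assumes "\<alpha> \<in> cochains X i" "\<beta> \<in> cochains X j"
  shows "steenrod_product X n i j \<alpha> \<beta> \<in> cochains X (i + j - n)"
proof -
  define N where "N = i + j - n"
  have "eval_face X i \<alpha> N u (steenrod_odd N ks) * eval_face X j \<beta> N u (steenrod_even N ks) = 0"
    if u: "u \<in> degenerate_simplices X N" and ks: "set ks \<subseteq> {0..N}" for u ks
  proof -
    from u obtain l p v where v: "N = Suc l" "u = degen X l p v" "p \<le> l" "v \<in> simplices X l"
      by (auto simp: degenerate_simplices_def)
    have sub: "steenrod_odd N ks \<subseteq> {..Suc l}" "steenrod_even N ks \<subseteq> {..Suc l}"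
      using steenrod_interval_subset[of ks N] ks v(1)
      unfolding steenrod_odd_def steenrod_even_def by (simp_all add: atLeast0AtMost UN_subset_iff)
    obtain m where "1 \<le> m" "m \<le> length ks + 1" "{p, Suc p} \<subseteq> steenrod_interval N ks m"
      using edge_in_steenrod_interval[of p N ks] v by auto
    then have "{p, Suc p} \<subseteq> steenrod_odd N ks \<or> {p, Suc p} \<subseteq> steenrod_even N ks"
      by (cases "odd m") (auto simp: steenrod_odd_def steenrod_even_def)
    then show ?thesis
      using eval_face_degen[OF assms(1) v(4,3) sub(1)] eval_face_degen[OF assms(2) v(4,3) sub(2)] v
      by auto
  qed
  then show ?thesis
    unfolding cochains_def steenrod_product_def N_def by (auto intro!: sum.neutral)
qed


subsection \<open>Normalized cochains as the dual of the normalized chains\<close>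

context simplicial_set
begin

lemma equiv_normalization_rel: "equiv (simplicial_chains X k) (normalization_rel X k)"
proof (intro equivI)
  show "refl_on (simplicial_chains X k) (normalization_rel X k)"
    by (auto simp: refl_on_def normalization_rel_def)
  show "sym (normalization_rel X k)"
    unfolding sym_def normalization_rel_def by (auto simp: in_keys_iff lookup_minus)
  show "trans (normalization_rel X k)"
  proof (rule transI)
    fix a b c assume "(a, b) \<in> normalization_rel X k" "(b, c) \<in> normalization_rel X k"
    moreover have "a - c = (a - b) + (b - c)" by simp
    ultimately show "(a, c) \<in> normalization_rel X k"
      unfolding normalization_rel_def using keys_add[of "a - b" "b - c"] by auto
  qed
qed (auto simp: normalization_rel_def)

lemma chain_induct [consumes 1, case_names zero single add]:
  assumes "c \<in> simplicial_chains X k" "P 0"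
    and "\<And>u. u \<in> simplices X k \<Longrightarrow> P (Poly_Mapping.single u 1)"
    and "\<And>a b. \<lbrakk>a \<in> simplicial_chains X k; b \<in> simplicial_chains X k; P a; P b\<rbrakk> \<Longrightarrow> P (a + b)"
  shows "P c"
proof -
  have "finite A \<Longrightarrow> A \<subseteq> simplices X k \<Longrightarrow>
      (\<Sum>u\<in>A. Poly_Mapping.single u (1::bit)) \<in> simplicial_chains X k \<and> P (\<Sum>u\<in>A. Poly_Mapping.single u 1)"
    for A
  proof (induction A rule: finite_induct)
    case empty
    then show ?case using assms(2) by (simp add: simplicial_chains_def)
  next
    case (insert u A)
    then have "Poly_Mapping.single u 1 \<in> simplicial_chains X k" by (simp add: simplicial_chains_def)
    moreover have "a + b \<in> simplicial_chains X k" if "a \<in> simplicial_chains X k" "b \<in> simplicial_chains X k"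
      for a b :: "'a \<Rightarrow>\<^sub>0 bit"
      using that keys_add[of a b] by (auto simp: simplicial_chains_def)
    ultimately show ?case using insert assms(3,4) by simp
  qed
  moreover have "c = (\<Sum>u\<in>Poly_Mapping.keys c. Poly_Mapping.single u 1)"
    by (rule poly_mapping_eqI)
      (auto simp: lookup_sum lookup_single when_def sum.delta in_keys_iff)
  ultimately show ?thesis
    using assms(1) by (metis simplicial_chains_def finite_keys mem_Collect_eq)
qed

theorem bij_betw_dual_cochains:
  "bij_betw
     (\<lambda>\<phi> u. if u \<in> simplices X k then \<phi> (chain_class X k (Poly_Mapping.single u 1)) else 0)
     (normalized_chains_dual X k) (cochains X k)"
  (is "bij_betw ?F ?D ?C")
proof (rule bij_betwI')
  have at_0: "\<phi> (chain_class X k 0) = 0" if "\<phi> \<in> ?D" for \<phi>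
  proof -
    have "0 \<in> simplicial_chains X k" by (simp add: simplicial_chains_def)
    with that have "\<phi> (chain_class X k (0 + 0)) = \<phi> (chain_class X k 0) + \<phi> (chain_class X k 0)"
      unfolding normalized_chains_dual_def by blast
    then show ?thesis by simp
  qed
  fix \<phi> \<psi> assume D: "\<phi> \<in> ?D" "\<psi> \<in> ?D"
  have "\<phi> = \<psi>" if eq: "?F \<phi> = ?F \<psi>"
  proof (rule extensionalityI)
    show "\<phi> \<in> extensional (normalized_chains X k)" "\<psi> \<in> extensional (normalized_chains X k)"
      using D by (auto simp: normalized_chains_dual_def)
    fix z assume "z \<in> normalized_chains X k"
    then obtain c where c: "c \<in> simplicial_chains X k" "z = chain_class X k c"
      unfolding normalized_chains_def by (auto elim: quotientE)
    from c(1) have "\<phi> (chain_class X k c) = \<psi> (chain_class X k c)"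
    proof (induction rule: chain_induct)
      case zero
      then show ?case using at_0[OF D(1)] at_0[OF D(2)] by simp
    next
      case (single u)
      then show ?case using fun_cong[OF eq, of u] by simp
    next
      case (add a b)
      then show ?case using D by (simp add: normalized_chains_dual_def)
    qed
    with c show "\<phi> z = \<psi> z" by simp
  qed
  then show "(?F \<phi> = ?F \<psi>) = (\<phi> = \<psi>)" by blast
next
  fix \<phi> assume D: "\<phi> \<in> ?D"
  have "\<phi> (chain_class X k (Poly_Mapping.single u 1)) = 0"
    if u: "u \<in> degenerate_simplices X k" for u
  proof -
    have 0: "(0::'a \<Rightarrow>\<^sub>0 bit) \<in> simplicial_chains X k" by (simp add: simplicial_chains_def)
    have "(Poly_Mapping.single u 1, 0) \<in> normalization_rel X k"
      using u degenerate_simplices_subset by (auto simp: normalization_rel_def simplicial_chains_def)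
    then have "chain_class X k (Poly_Mapping.single u 1) = chain_class X k 0"
      by (rule equiv_class_eq[OF equiv_normalization_rel])
    moreover have "\<phi> (chain_class X k (0 + 0)) = \<phi> (chain_class X k 0) + \<phi> (chain_class X k 0)"
      using D 0 unfolding normalized_chains_dual_def by blast
    ultimately show ?thesis by simp
  qed
  then show "?F \<phi> \<in> ?C" by (auto simp: cochains_def)
next
  fix \<alpha> assume C: "\<alpha> \<in> ?C"
  define E where "E c = (\<Sum>u\<in>Poly_Mapping.keys c. \<alpha> u * Poly_Mapping.lookup c u)"
    for c :: "'a \<Rightarrow>\<^sub>0 bit"
  have E_alt: "E c = (\<Sum>u\<in>A. \<alpha> u * Poly_Mapping.lookup c u)"
    if "finite A" "Poly_Mapping.keys c \<subseteq> A" for c A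
    unfolding E_def using that by (intro sum.mono_neutral_left) (auto simp: in_keys_iff)
  have E_add: "E (a + b) = E a + E b" for a b
    using keys_add[of a b]
    by (simp only: E_alt[of "Poly_Mapping.keys a \<union> Poly_Mapping.keys b"] lookup_add
        distrib_left sum.distrib finite_UnI finite_keys Un_upper1 Un_upper2)
  have E_rel: "E a = E b" if "(a, b) \<in> normalization_rel X k" for a b
  proof -
    have "E (a - b) = 0"
      using that C unfolding E_def normalization_rel_def cochains_def
      by (intro sum.neutral) auto
    with E_add[of "a - b" b] show ?thesis by simp
  qed
  define \<phi> where "\<phi> = restrict (\<lambda>z. E (SOME c. c \<in> z)) (normalized_chains X k)"
  have \<phi>: "\<phi> (chain_class X k c) = E c" if c: "c \<in> simplicial_chains X k" for c
  proof -
    have "c \<in> chain_class X k c"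
      by (rule equiv_class_self[OF equiv_normalization_rel c])
    then have "(SOME d. d \<in> chain_class X k c) \<in> chain_class X k c" by (rule someI)
    then have "E c = E (SOME d. d \<in> chain_class X k c)" by (intro E_rel) simp
    with c show ?thesis by (simp add: \<phi>_def normalized_chains_def quotientI)
  qed
  have "a + b \<in> simplicial_chains X k" if "a \<in> simplicial_chains X k" "b \<in> simplicial_chains X k"
    for a b :: "'a \<Rightarrow>\<^sub>0 bit"
    using that keys_add[of a b] by (auto simp: simplicial_chains_def)
  then have "\<phi> \<in> ?D"
    by (auto simp: normalized_chains_dual_def \<phi> E_add) (simp add: \<phi>_def)
  moreover have "\<alpha> = ?F \<phi>"
  proof
    fix u
    show "\<alpha> u = ?F \<phi> u"
    proof (cases "u \<in> simplices X k")
      case True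
      then have "Poly_Mapping.single u 1 \<in> simplicial_chains X k" by (simp add: simplicial_chains_def)
      with True show ?thesis by (cases "\<alpha> u") (simp_all add: \<phi> E_def)
    next
      case False
      with C show ?thesis by (simp add: cochains_def)
    qed
  qed
  ultimately show "\<exists>\<phi>\<in>?D. \<alpha> = ?F \<phi>" by blast
qed

end


subsection \<open>The non-degenerate simplices of \<open>B\<Sigma>\<^sub>2\<close>\<close>

lemma carrier_Sigma2: "carrier Sigma2 = {\<one>\<^bsub>Sigma2\<^esub>, T}"
proof -
  have *: "{1..2} = {1, 2::nat}" by auto
  have "{p. p permutes {1..2::nat}} = {id, transpose 1 2}"
    unfolding * by (auto simp: permutes_doubleton_iff)
  then show ?thesis by (simp add: sym_group_def T_def)
qed

lemma T_neq_one: "T \<noteq> \<one>\<^bsub>Sigma2\<^esub>"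
proof
  assume "T = \<one>\<^bsub>Sigma2\<^esub>"
  then have "T 1 = 1" by (simp add: sym_group_one)
  then show False by (simp add: T_def)
qed

lemma T_mult_T: "T \<otimes>\<^bsub>Sigma2\<^esub> T = \<one>\<^bsub>Sigma2\<^esub>"
  by (simp add: sym_group_mult sym_group_one T_def)

lemma T_pow: "T [^]\<^bsub>Sigma2\<^esub> (m::nat) = (if even m then \<one>\<^bsub>Sigma2\<^esub> else T)"
proof -
  interpret group Sigma2 by (rule sym_group_is_group)
  show ?thesis by (induction m) (auto simp: T_mult_T carrier_Sigma2)
qed

lemma nondegenerate_BSigma2: "nondegenerate_simplices (BG Sigma2) k = {x_simplex k}"
proof -
  interpret group Sigma2 by (rule sym_group_is_group)
  let ?alt = "\<lambda>gs. \<forall>p. Suc p < length gs \<longrightarrow> gs ! p \<noteq> (gs ! Suc p :: nat \<Rightarrow> nat)"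
  have x_alt: "?alt (x_tilde k)" for k
    using T_neq_one T_neq_one[symmetric] by (simp add: x_tilde_def T_pow del: upt_Suc)
  have x_in: "x_tilde k \<in> simplices (EG Sigma2) k"
    by (auto simp: x_tilde_def T_pow carrier_Sigma2)
  have self: "gs \<in> EG_orbit Sigma2 gs" if "gs \<in> simplices (EG Sigma2) k" for gs k
  proof -
    have "EG_act Sigma2 \<one>\<^bsub>Sigma2\<^esub> gs = gs"
      using that by (auto simp: EG_act_def intro!: map_idI)
    then show ?thesis unfolding EG_orbit_def by (metis image_eqI one_closed)
  qed
  have alt_orbit: "?alt hs"
    if orb: "hs \<in> EG_orbit Sigma2 gs" and gs: "gs \<in> simplices (EG Sigma2) k" and alt: "?alt gs"
    for hs gs k
  proof (intro allI impI)
    fix p assume p: "Suc p < length hs"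
    obtain g where g: "g \<in> carrier Sigma2" "hs = EG_act Sigma2 g gs"
      using orb by (auto simp: EG_orbit_def)
    have "gs ! p \<in> carrier Sigma2" "gs ! Suc p \<in> carrier Sigma2"
      using gs p g(2) by (auto simp: EG_act_def intro!: subsetD[OF _ nth_mem])
    with g p alt show "hs ! p \<noteq> hs ! Suc p" by (simp add: EG_act_def Units_eq)
  qed
  have "x_simplex k \<notin> degenerate_simplices (BG Sigma2) k"
  proof
    assume "x_simplex k \<in> degenerate_simplices (BG Sigma2) k"
    then obtain l p gs where gs: "k = Suc l" "p \<le> l" "gs \<in> simplices (EG Sigma2) l"
        "x_simplex k = EG_orbit Sigma2 (degen (EG Sigma2) l p gs)"
      by (auto simp: degenerate_simplices_def BG_simps simp del: EG_simps)
    have "degen (EG Sigma2) l p gs \<in> simplices (EG Sigma2) (Suc l)"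
      using simplicial_set.degen_closed[OF simplicial_set_EG gs(3,2)] .
    then have "degen (EG Sigma2) l p gs \<in> x_simplex k" using self gs(4) by metis
    then have "?alt (degen (EG Sigma2) l p gs)"
      using alt_orbit x_in x_alt unfolding x_simplex_def by blast
    with gs(2,3) show False
      by (auto simp: nth_append min_def dest!: spec[of _ p] split: if_splits)
  qed
  moreover have "EG_orbit Sigma2 gs = x_simplex k"
    if gs: "gs \<in> simplices (EG Sigma2) k"
      and nd: "EG_orbit Sigma2 gs \<notin> degenerate_simplices (BG Sigma2) k" for gs
  proof -
    have alt: "?alt gs"
    proof (intro allI impI notI)
      fix p assume p: "Suc p < length gs" "gs ! p = gs ! Suc p"
      then obtain l where l: "k = Suc l" using gs by (cases k) auto
      have p_le: "p \<le> l" using p gs l by simp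
      have deg: "gs = degen (EG Sigma2) l p (face (EG Sigma2) k p gs)"
        using p gs l by (auto intro!: nth_equalityI simp: nth_append min_def less_Suc_eq not_less
            Suc_diff_le)
      have "face (EG Sigma2) k p gs \<in> simplices (EG Sigma2) l"
        using simplicial_set.face_closed[OF simplicial_set_EG gs[unfolded l], of p] p_le l by simp
      then have "EG_orbit Sigma2 (face (EG Sigma2) k p gs) \<in> simplices (BG Sigma2) l"
        unfolding BG_simps by (rule imageI)
      moreover have "EG_orbit Sigma2 gs
          = degen (BG Sigma2) l p (EG_orbit Sigma2 (face (EG Sigma2) k p gs))"
        unfolding BG_simps by (rule arg_cong[OF deg])
      ultimately have "EG_orbit Sigma2 gs \<in> degenerate_simplices (BG Sigma2) k"
        unfolding degenerate_simplices_def l using p_le by blast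
      with nd show False by simp
    qed
    have len: "length gs = Suc k" using gs by simp
    have in_G: "gs ! m \<in> {\<one>\<^bsub>Sigma2\<^esub>, T}" if "m \<le> k" for m
      using that len gs subsetD[OF _ nth_mem, of gs "carrier Sigma2" m]
      by (simp add: carrier_Sigma2)
    have nth: "gs ! m = gs ! 0 \<otimes>\<^bsub>Sigma2\<^esub> T [^]\<^bsub>Sigma2\<^esub> m" if "m \<le> k" for m
      using that
    proof (induction m)
      case 0
      then show ?case using in_G[of 0] by (auto simp: carrier_Sigma2)
    next
      case (Suc m)
      then have IH: "gs ! m = gs ! 0 \<otimes>\<^bsub>Sigma2\<^esub> T [^]\<^bsub>Sigma2\<^esub> m" by simp
      have ne: "gs ! m \<noteq> gs ! Suc m"
        and m: "gs ! m \<in> {\<one>\<^bsub>Sigma2\<^esub>, T}" "gs ! Suc m \<in> {\<one>\<^bsub>Sigma2\<^esub>, T}"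
        and 0: "gs ! 0 \<in> {\<one>\<^bsub>Sigma2\<^esub>, T}"
        using alt[rule_format, of m] in_G[of m] in_G[of "Suc m"] in_G[of 0] len Suc.prems
        by simp_all
      have T: "T \<in> carrier Sigma2" by (simp add: carrier_Sigma2)
      have "a \<otimes>\<^bsub>Sigma2\<^esub> T \<in> {\<one>\<^bsub>Sigma2\<^esub>, T} - {a}" if "a \<in> {\<one>\<^bsub>Sigma2\<^esub>, T}" for a
        using that T_neq_one T_neq_one[symmetric] T_mult_T l_one[OF T] by fastforce
      from this[OF m(1)] have "gs ! Suc m = gs ! m \<otimes>\<^bsub>Sigma2\<^esub> T"
        using ne m by (metis Diff_iff empty_iff insert_iff)
      also have "\<dots> = gs ! 0 \<otimes>\<^bsub>Sigma2\<^esub> T [^]\<^bsub>Sigma2\<^esub> Suc m"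
        unfolding IH nat_pow_Suc using 0[folded carrier_Sigma2] T by (simp add: m_assoc)
      finally show ?case .
    qed
    have act: "gs = EG_act Sigma2 (gs ! 0) (x_tilde k)"
    proof (rule nth_equalityI)
      fix m assume "m < length gs"
      with len have m: "m < Suc k" by simp
      then show "gs ! m = EG_act Sigma2 (gs ! 0) (x_tilde k) ! m"
        using nth[of m] by (simp add: EG_act_def x_tilde_def del: upt_Suc)
    qed (simp add: len EG_act_def x_tilde_def)
    have orb: "EG_orbit Sigma2 (EG_act Sigma2 h hs) = EG_orbit Sigma2 hs"
      if h: "h \<in> carrier Sigma2" and hs: "hs \<in> simplices (EG Sigma2) k" for h hs
    proof -
      have *: "EG_act Sigma2 g (EG_act Sigma2 h hs) = EG_act Sigma2 (g \<otimes>\<^bsub>Sigma2\<^esub> h) hs"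
        if "g \<in> carrier Sigma2" for g
        using that h hs by (auto simp: EG_act_def m_assoc subset_iff)
      have "EG_orbit Sigma2 (EG_act Sigma2 h hs)
          = (\<lambda>g. EG_act Sigma2 g hs) ` (\<lambda>g. g \<otimes>\<^bsub>Sigma2\<^esub> h) ` carrier Sigma2"
        unfolding EG_orbit_def image_image by (intro image_cong refl *)
      moreover have "(\<lambda>g. g \<otimes>\<^bsub>Sigma2\<^esub> h) ` carrier Sigma2 = carrier Sigma2"
      proof (intro equalityI subsetI)
        fix g assume "g \<in> carrier Sigma2"
        with h show "g \<in> (\<lambda>g. g \<otimes>\<^bsub>Sigma2\<^esub> h) ` carrier Sigma2"
          by (intro image_eqI[of _ _ "g \<otimes>\<^bsub>Sigma2\<^esub> inv\<^bsub>Sigma2\<^esub> h"])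
            (auto simp: m_assoc simp del: sym_group_inv_equality)
      qed (use h in auto)
      ultimately show ?thesis by (simp add: EG_orbit_def)
    qed
    have "EG_orbit Sigma2 gs = EG_orbit Sigma2 (EG_act Sigma2 (gs ! 0) (x_tilde k))"
      by (rule arg_cong[OF act])
    also have "\<dots> = x_simplex k"
      unfolding x_simplex_def by (rule orb[OF in_G[OF le0, folded carrier_Sigma2] x_in])
    finally show ?thesis .
  qed
  moreover have "x_simplex k \<in> simplices (BG Sigma2) k"
    unfolding BG_simps x_simplex_def using x_in by (rule imageI)
  ultimately show ?thesis
    unfolding nondegenerate_simplices_def BG_simps by blast
qed

lemma t_cochain_in_cochains: "t_cochain k \<in> cochains (BG Sigma2) k"
  using nondegenerate_BSigma2[of k]
  by (auto simp: nondegenerate_simplices_def t_cochain_def dual_cochain_def cochains_def)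

end

theory Submission
  imports Defs
begin

text \<open>
  Evaluate both sides on \<open>x_simplex N\<close> with \<open>N = i + j - n\<close>. A face of \<open>x_simplex N\<close> is
  non-degenerate iff consecutive vertices have different parity, so a tuple \<open>k\<^sub>1 < \<dots> < k\<^sub>n\<^sub>+\<^sub>1\<close>
  contributes iff all \<open>k\<^sub>m\<^sub>+\<^sub>1 - k\<^sub>m\<close> are odd and the two faces have \<open>i + 1\<close> and \<open>j + 1\<close> vertices.
  Mark the number of vertices of the two faces by two variables. The first and the last
  interval have arbitrary length and contribute \<open>z = x / (1 - x)\<close> each; the other ones have odd
  length and contribute \<open>x\<^sup>2 / (1 - x\<^sup>2)\<close>, which is \<open>z\<^sup>2\<close> modulo 2. Whatever the parity of \<open>n\<close>,
  each of the two variables therefore occurs as \<open>z\<^sup>n\<^sup>+\<^sup>1\<close>, whose coefficient at \<open>x\<^sup>i\<^sup>+\<^sup>1\<close> is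
  \<open>i choose n\<close>.
\<close>

section \<open>Powers of \<open>x / (1 - x)\<close> modulo 2\<close>

text \<open>\<open>geom_coeff m a\<close> is the coefficient of \<open>x\<^sup>a\<close> in \<open>(x / (1 - x))\<^sup>m\<close>.\<close>

fun geom_coeff :: "nat \<Rightarrow> nat \<Rightarrow> bit" where
  "geom_coeff 0 a = (if a = 0 then 1 else 0)"
| "geom_coeff (Suc m) 0 = 0"
| "geom_coeff (Suc m) (Suc a) = geom_coeff (Suc m) a + geom_coeff m a"

lemma geom_coeff_choose: "geom_coeff (Suc m) (Suc a) = of_nat (a choose m)"
proof (induction a arbitrary: m)
  case 0
  then show ?case by (cases m) simp_all
next
  case (Suc a)
  show ?case
  proof (cases m)
    case 0
    then show ?thesis using Suc[of 0] by simp
  next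
    case m: (Suc m')
    have "geom_coeff (Suc m) (Suc (Suc a)) = geom_coeff (Suc m) (Suc a) + geom_coeff m (Suc a)"
      by (rule geom_coeff.simps)
    also have "\<dots> = of_nat (Suc a choose m)"
      unfolding m Suc by (simp only: binomial_Suc_Suc of_nat_add add.commute)
    finally show ?thesis .
  qed
qed

lemma geom_coeff_eq_0: "a < m \<Longrightarrow> geom_coeff m a = 0"
  by (induction m a rule: geom_coeff.induct) auto

text \<open>Coefficient form of \<open>z^(m+1) = z * z^m\<close>, where
  \<open>z = x / (1 - x)\<close> is the sum of all \<open>x^(d+1)\<close>.\<close>

lemma sum_geom_coeff: "(\<Sum>d<a. geom_coeff m (a - Suc d)) = geom_coeff (Suc m) a"
proof (induction a)
  case (Suc a)
  have "(\<Sum>d<Suc a. geom_coeff m (Suc a - Suc d))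
      = geom_coeff m a + (\<Sum>d<a. geom_coeff m (a - Suc d))"
    unfolding sum.lessThan_Suc_shift by simp
  with Suc show ?case by (simp only: geom_coeff.simps add.commute)
qed simp

text \<open>Modulo 2, \<open>(1 - x)^2 = 1 - x^2\<close>, hence
  \<open>(1 - x^2) * z^(m+2) = x^2 * z^m\<close>. In the recursion this is the cancellation of the
  two equal middle terms.\<close>

lemma geom_coeff_Suc_Suc:
  "geom_coeff (Suc (Suc m)) (Suc (Suc a)) = geom_coeff (Suc (Suc m)) a + geom_coeff m a"
proof -
  have "x + y + (y + z) = x + z" for x y z :: bit
    by (cases x; cases y; cases z) simp_all
  then show ?thesis by simp
qed

text \<open>Multiplication of \<open>z^m\<close> by \<open>x^2 / (1 - x^2)\<close>, the sum of
  \<open>x^(d+1)\<close> over odd \<open>d\<close>, which is \<open>z^2\<close> modulo 2.\<close>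

lemma sum_odd_geom_coeff:
  "(\<Sum>d<a. if odd d then geom_coeff m (a - Suc d) else 0) = geom_coeff (Suc (Suc m)) a"
proof (induction a rule: induct_nat_012)
  case (ge2 a)
  have "(\<Sum>d<Suc (Suc a). if odd d then geom_coeff m (Suc (Suc a) - Suc d) else 0)
      = geom_coeff m a + (\<Sum>d<a. if odd d then geom_coeff m (a - Suc d) else 0)"
    unfolding sum.lessThan_Suc_shift by (simp cong: if_cong)
  with ge2(1) show ?case by (simp only: geom_coeff_Suc_Suc add.commute)
qed simp_all


section \<open>Sums over increasing lists\<close>

text \<open>The lower bound \<open>s\<close> makes the tails behind a fixed first entry a set of the
  same kind; \<open>steenrod_product\<close> sums over the case \<open>s = 0\<close>.\<close>

definition increasing_lists :: "nat \<Rightarrow> nat \<Rightarrow> nat \<Rightarrow> nat list set" where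
  "increasing_lists m s N = {ks. length ks = m \<and> sorted_wrt (<) ks \<and> set ks \<subseteq> {s..N}}"

lemma increasing_lists_0 [simp]: "increasing_lists 0 s N = {[]}"
  by (auto simp: increasing_lists_def)

lemma increasing_lists_Suc:
  "increasing_lists (Suc m) s N
     = (\<lambda>(k, ks). k # ks) ` (SIGMA k:{s..N}. increasing_lists m (Suc k) N)"
proof (intro equalityI subsetI)
  fix ks assume "ks \<in> increasing_lists (Suc m) s N"
  then show "ks \<in> (\<lambda>(k, ks). k # ks) ` (SIGMA k:{s..N}. increasing_lists m (Suc k) N)"
    by (cases ks) (auto simp: increasing_lists_def image_iff Suc_le_eq)
qed (fastforce simp: increasing_lists_def Suc_le_eq)

lemma finite_increasing_lists: "finite (increasing_lists m s N)"
  by (induction m arbitrary: s) (simp_all add: increasing_lists_Suc)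

lemma sum_increasing_lists_Suc:
  "(\<Sum>ks\<in>increasing_lists (Suc m) s N. f ks)
     = (\<Sum>k=s..N. \<Sum>ks\<in>increasing_lists m (Suc k) N. f (k # ks))"
proof -
  have "inj_on (\<lambda>(k, ks). k # ks) A" for A :: "(nat \<times> nat list) set"
    by (auto simp: inj_on_def)
  then show ?thesis
    unfolding increasing_lists_Suc
    by (simp add: sum.reindex sum.Sigma finite_increasing_lists case_prod_unfold)
qed


section \<open>The vertices of the two faces\<close>

text \<open>
  The vertices, in increasing order, of the union of every other interval of the subdivision of
  \<open>{s..N}\<close> at \<open>ks\<close>; \<open>c\<close> tells whether the first interval belongs to it.
\<close>

fun alternate_intervals :: "bool \<Rightarrow> nat \<Rightarrow> nat \<Rightarrow> nat list \<Rightarrow> nat list" where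
  "alternate_intervals c N s [] = (if c then [s..<Suc N] else [])"
| "alternate_intervals c N s (k # ks)
     = (if c then [s..<Suc k] else []) @ alternate_intervals (\<not> c) N k ks"

lemma set_alternate_intervals:
  "set (alternate_intervals c N s ks)
     = (\<Union>m\<in>{m. m \<le> length ks \<and> even m = c}. {(s # ks @ [N]) ! m .. (ks @ [N]) ! m})"
proof (induction ks arbitrary: s c)
  case Nil
  then show ?case by auto
next
  case (Cons k ks)
  have "{m. m \<le> length (k # ks) \<and> even m = c}
      = (if c then {0} else {}) \<union> Suc ` {m. m \<le> length ks \<and> even m = (\<not> c)}"
  proof (intro equalityI subsetI)
    fix m assume "m \<in> {m. m \<le> length (k # ks) \<and> even m = c}"
    then show "m \<in> (if c then {0} else {}) \<union> Suc ` {m. m \<le> length ks \<and> even m = (\<not> c)}"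
      by (cases m) auto
  qed (auto split: if_splits)
  then show ?case
    by (auto simp: Cons.IH atLeastLessThanSuc_atLeastAtMost simp del: upt_Suc)
qed

lemma steenrod_odd_even_eq:
  "steenrod_odd N ks = set (alternate_intervals True N 0 ks)"
  "steenrod_even N ks = set (alternate_intervals False N 0 ks)"
proof -
  \<comment> \<open>\<open>steenrod_interval\<close> is numbered from 1 and
    \<open>set_alternate_intervals\<close> from 0, so odd and even change places.\<close>
  have *: "{m. 1 \<le> m \<and> m \<le> length ks + 1 \<and> P m} = Suc ` {m. m \<le> length ks \<and> P (Suc m)}" for P
  proof (intro equalityI subsetI)
    fix m assume "m \<in> {m. 1 \<le> m \<and> m \<le> length ks + 1 \<and> P m}"
    then show "m \<in> Suc ` {m. m \<le> length ks \<and> P (Suc m)}" by (cases m) auto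
  qed auto
  show "steenrod_odd N ks = set (alternate_intervals True N 0 ks)"
    "steenrod_even N ks = set (alternate_intervals False N 0 ks)"
    unfolding steenrod_odd_def steenrod_even_def steenrod_interval_def set_alternate_intervals *
    by simp_all
qed

text \<open>The strict bound for \<open>c = False\<close> carries the induction: behind an interval
  ending at \<open>k\<close>, the same face resumes only beyond \<open>k\<close>.\<close>

lemma alternate_intervals_sorted:
  assumes "sorted_wrt (<) ks" "set ks \<subseteq> {s<..N}"
  shows "sorted_wrt (<) (alternate_intervals c N s ks)
    \<and> set (alternate_intervals c N s ks) \<subseteq> (if c then {s..N} else {s<..N})"
  using assms
proof (induction ks arbitrary: s c)
  case Nil
  then show ?case by (auto simp del: upt_Suc)
next
  case (Cons k ks)
  then have "sorted_wrt (<) (alternate_intervals (\<not> c) N k ks)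
    \<and> set (alternate_intervals (\<not> c) N k ks) \<subseteq> (if \<not> c then {k..N} else {k<..N})"
    by (intro Cons.IH) auto
  moreover have "s < k" "k \<le> N"
    using Cons.prems(2) by auto
  ultimately show ?case
    by (cases c) (fastforce simp: sorted_wrt_append simp del: upt_Suc)+
qed

section \<open>Parity of consecutive vertices\<close>

abbreviation parity_alternating :: "nat list \<Rightarrow> bool" where
  "parity_alternating \<equiv> successively (\<lambda>p q. even p = odd q)"

lemma parity_alternating_upt: "parity_alternating [p..<q]"
  by (simp add: successively_conv_nth)

lemma alternate_intervals_Cons_hd:
  assumes "s \<le> N" "sorted_wrt (<) ks" "set ks \<subseteq> {s<..N}"
  shows "\<exists>ls. alternate_intervals True N s ks = s # ls"
  using assms by (cases ks) (auto simp: upt_conv_Cons simp del: upt_Suc)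

text \<open>Inside an interval parities alternate anyway. A face jumps only across an interval of
  the other face, from one entry of \<open>k # ks\<close> to the next, and each such jump occurs in
  exactly one of the two faces.\<close>

lemma parity_alternating_alternate_intervals:
  assumes "sorted_wrt (<) (k # ks)" "set (k # ks) \<subseteq> {..N}" "s \<le> k"
  shows "parity_alternating (alternate_intervals True N s (k # ks))
      \<and> parity_alternating (alternate_intervals False N s (k # ks))
    \<longleftrightarrow> parity_alternating (k # ks)"
  using assms
proof (induction ks arbitrary: k s)
  case Nil
  then show ?case using parity_alternating_upt by (simp del: upt_Suc)
next
  case (Cons k' ks)
  have "k' \<le> N" "sorted_wrt (<) ks" "set ks \<subseteq> {k'<..N}"
    using Cons.prems by fastforce+
  then obtain ls where ls: "alternate_intervals True N k' ks = k' # ls"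
    using alternate_intervals_Cons_hd by blast
  have "parity_alternating (alternate_intervals True N k (k' # ks))
      \<and> parity_alternating (alternate_intervals False N k (k' # ks))
    \<longleftrightarrow> parity_alternating (k' # ks)"
    using Cons.prems by (intro Cons.IH) auto
  with Cons.prems(3) show ?case
    using parity_alternating_upt[of s "Suc k"]
    by (auto simp: ls successively_append_iff simp del: upt_Suc)
qed

text \<open>With \<open>s\<close> as a break already chosen, all intervals but the last have odd
  length and give \<open>z^2\<close>, the last one gives \<open>z\<close>. For either parity of
  \<open>m\<close> the powers are \<open>z^(m+1)\<close> and \<open>z^m\<close>. The condition on
  \<open>a + b\<close> counts the \<open>m\<close> shared vertices twice.\<close>

lemma sum_alternate_intervals:
  assumes "s \<le> N"
  shows "(\<Sum>ks\<in>increasing_lists m (Suc s) N.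
        if parity_alternating (s # ks) \<and> length (alternate_intervals True N s ks) = a
          \<and> length (alternate_intervals False N s ks) = b then 1 else 0)
    = (if a + b = Suc (N - s) + m then geom_coeff (Suc m) a * geom_coeff m b else 0)"
  using assms
proof (induction m arbitrary: s a b)
  case 0
  have "geom_coeff (Suc 0) (Suc c) = 1" for c
    by (simp only: geom_coeff_choose) simp
  with 0 show ?case by (auto simp: Suc_diff_le)
next
  case (Suc m)
  let ?P = "\<lambda>s a b ks. parity_alternating (s # ks) \<and> length (alternate_intervals True N s ks) = a
          \<and> length (alternate_intervals False N s ks) = b"
  have "(\<Sum>ks\<in>increasing_lists (Suc m) (Suc s) N. if ?P s a b ks then 1 else 0)
      = (\<Sum>k=Suc s..N. \<Sum>ks\<in>increasing_lists m (Suc k) N. if ?P s a b (k # ks) then 1 else 0 :: bit)"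
    by (rule sum_increasing_lists_Suc)
  \<comment> \<open>Splitting off the first interval, with \<open>Suc (k - s)\<close> vertices,
    exchanges the roles of the two faces. The guard keeps the subtraction from truncating.\<close>
  also have "\<dots> = (\<Sum>k=Suc s..N. if (even s = odd k) \<and> Suc (k - s) \<le> a
      then \<Sum>ks\<in>increasing_lists m (Suc k) N. if ?P k b (a - Suc (k - s)) ks then 1 else 0 else 0)"
  proof (intro sum.cong refl)
    fix k assume "k \<in> {Suc s..N}"
    then have "?P s a b (k # ks) \<longleftrightarrow> ((even s = odd k) \<and> Suc (k - s) \<le> a) \<and> ?P k b (a - Suc (k - s)) ks"
      for ks by (auto simp: Suc_diff_le)
    then show "(\<Sum>ks\<in>increasing_lists m (Suc k) N. if ?P s a b (k # ks) then 1 else 0 :: bit)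
        = (if (even s = odd k) \<and> Suc (k - s) \<le> a
          then \<Sum>ks\<in>increasing_lists m (Suc k) N. if ?P k b (a - Suc (k - s)) ks then 1 else 0 else 0)"
      by (cases "(even s = odd k) \<and> Suc (k - s) \<le> a")
        (simp_all only: simp_thms if_True if_False sum.neutral_const)
  qed
  also have "\<dots> = (\<Sum>k=Suc s..N. if (even s = odd k) \<and> Suc (k - s) \<le> a
      then (if a + b = Suc (N - s) + Suc m
        then geom_coeff (Suc m) b * geom_coeff m (a - Suc (k - s)) else 0) else 0)"
    by (intro sum.cong refl if_cong) (auto simp: Suc.IH)
  also have "\<dots> = (if a + b = Suc (N - s) + Suc m
      then geom_coeff (Suc m) b * geom_coeff (Suc (Suc m)) a else 0)"
  \<comment> \<open>A nonzero coefficient forces \<open>b > m\<close>, so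
    \<open>a \<le> Suc (N - s)\<close> and the bound \<open>N\<close> cuts off no term with
    \<open>d = k - s < a\<close>. The missing \<open>d = 0\<close> is even.\<close>
  proof (cases "a + b = Suc (N - s) + Suc m \<and> geom_coeff (Suc m) b \<noteq> 0")
    case True
    then have "Suc m \<le> b" using geom_coeff_eq_0[of b "Suc m"] by fastforce
    have one: "geom_coeff (Suc m) b = 1"
      using True by (cases "geom_coeff (Suc m) b") simp_all
    from \<open>Suc m \<le> b\<close> True have a: "a \<le> Suc (N - s)" by simp
    have "(\<Sum>k=Suc s..N. if (even s = odd k) \<and> Suc (k - s) \<le> a
        then geom_coeff m (a - Suc (k - s)) else 0)
        = (\<Sum>d<a. if odd d then geom_coeff m (a - Suc d) else 0)"
    proof -
      let ?g = "\<lambda>d. if odd d \<and> d < a then geom_coeff m (a - Suc d) else 0"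
      have "(\<Sum>k=Suc s..N. if (even s = odd k) \<and> Suc (k - s) \<le> a
          then geom_coeff m (a - Suc (k - s)) else 0) = (\<Sum>k=Suc s..N. ?g (k - s))"
        by (intro sum.cong if_cong) auto
      also have "\<dots> = (\<Sum>d=1..N - s. ?g d)"
        by (rule sum.reindex_bij_witness[where i = "\<lambda>d. d + s" and j = "\<lambda>k. k - s"]) auto
      also have "\<dots> = (\<Sum>d<a. if odd d then geom_coeff m (a - Suc d) else 0)"
        using a by (intro sum.mono_neutral_cong) (auto simp: Suc_le_eq odd_pos)
      finally show ?thesis .
    qed
    then have "(\<Sum>k=Suc s..N. if (even s = odd k) \<and> Suc (k - s) \<le> a
        then geom_coeff (Suc m) b * geom_coeff m (a - Suc (k - s)) else 0)
        = geom_coeff (Suc m) b * geom_coeff (Suc (Suc m)) a"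
      unfolding one mult_1_left sum_odd_geom_coeff .
    with True show ?thesis by (simp cong: if_cong)
  qed (auto intro!: sum.neutral)
  finally show ?case by (simp add: mult.commute)
qed

text \<open>The first interval, ending at \<open>k\<close>, may have any length and is split off by
  hand. It contributes the factor \<open>z\<close> that raises the first face from
  \<open>z^n\<close> to \<open>z^(n+1)\<close>.\<close>

lemma sum_steenrod_faces:
  assumes "n \<le> i + j"
  shows "(\<Sum>ks\<in>increasing_lists (Suc n) 0 (i + j - n).
        if parity_alternating ks \<and> length (alternate_intervals True (i + j - n) 0 ks) = Suc i
          \<and> length (alternate_intervals False (i + j - n) 0 ks) = Suc j then 1 else 0)
    = (of_nat (i choose n) * of_nat (j choose n) :: bit)"
proof -
  define N where "N = i + j - n"
  let ?P = "\<lambda>k a b ks. parity_alternating (k # ks) \<and> length (alternate_intervals True N k ks) = a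
          \<and> length (alternate_intervals False N k ks) = b"
  have "(\<Sum>ks\<in>increasing_lists (Suc n) 0 N.
        if parity_alternating ks \<and> length (alternate_intervals True N 0 ks) = Suc i
          \<and> length (alternate_intervals False N 0 ks) = Suc j then 1 else 0)
      = (\<Sum>k=0..N. \<Sum>ks\<in>increasing_lists n (Suc k) N.
        if parity_alternating (k # ks) \<and> length (alternate_intervals True N 0 (k # ks)) = Suc i
          \<and> length (alternate_intervals False N 0 (k # ks)) = Suc j then 1 else 0 :: bit)"
    by (rule sum_increasing_lists_Suc)
  also have "\<dots> = (\<Sum>k=0..N. if k \<le> i
      then \<Sum>ks\<in>increasing_lists n (Suc k) N. if ?P k (Suc j) (i - k) ks then 1 else 0 else 0)"
    by (intro sum.cong refl) (auto intro!: sum.cong sum.neutral)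
  also have "\<dots> = (\<Sum>k=0..N. if k \<le> i then of_nat (j choose n) * geom_coeff n (i - k) else 0)"
    using assms
  proof (intro sum.cong refl if_cong)
    fix k assume "k \<in> {0..N}" "k \<le> i"
    with assms have "k \<le> N" "Suc j + (i - k) = Suc (N - k) + n"
      by (auto simp: N_def)
    then show "(\<Sum>ks\<in>increasing_lists n (Suc k) N. if ?P k (Suc j) (i - k) ks then 1 else 0)
        = of_nat (j choose n) * geom_coeff n (i - k)"
      by (simp only: sum_alternate_intervals geom_coeff_choose if_P)
  qed
  also have "\<dots> = of_nat (j choose n) * of_nat (i choose n)"
  \<comment> \<open>For \<open>j \<ge> n\<close> one has \<open>i \<le> N\<close>, so the sum
    reaches every \<open>k \<le> i\<close>; for \<open>j < n\<close> both sides vanish.\<close>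
  proof (cases "j < n")
    case False
    then have "(\<Sum>k=0..N. if k \<le> i then of_nat (j choose n) * geom_coeff n (i - k) else 0)
        = (\<Sum>k<Suc i. of_nat (j choose n) * geom_coeff n (Suc i - Suc k))"
      unfolding N_def by (intro sum.mono_neutral_cong_right) auto
    then show ?thesis
      by (simp only: sum_distrib_left[symmetric] sum_geom_coeff geom_coeff_choose)
  qed (simp add: binomial_eq_0 cong: if_cong)
  finally show ?thesis unfolding N_def by (simp add: mult.commute)
qed


section \<open>Faces of \<open>x_simplex N\<close>\<close>

lemma T_mult_T_pow: "T \<otimes>\<^bsub>Sigma2\<^esub> T [^]\<^bsub>Sigma2\<^esub> (m::nat) = T [^]\<^bsub>Sigma2\<^esub> Suc m"
proof -
  interpret group Sigma2 by (rule sym_group_is_group)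
  show ?thesis by (simp add: T_pow T_mult_T carrier_Sigma2)
qed

lemma T_pow_eq_iff: "T [^]\<^bsub>Sigma2\<^esub> (p::nat) = T [^]\<^bsub>Sigma2\<^esub> (q::nat) \<longleftrightarrow> even (p + q)"
  using T_neq_one T_neq_one[symmetric] by (simp add: T_pow)

lemma EG_orbit_T_pow:
  "EG_orbit Sigma2 (map (\<lambda>m. T [^]\<^bsub>Sigma2\<^esub> m) ps)
     = {map (\<lambda>m. T [^]\<^bsub>Sigma2\<^esub> m) ps, map (\<lambda>m. T [^]\<^bsub>Sigma2\<^esub> Suc m) ps}"
proof -
  interpret group Sigma2 by (rule sym_group_is_group)
  have "T [^]\<^bsub>Sigma2\<^esub> m \<in> carrier Sigma2" for m :: nat
    by (simp add: T_pow carrier_Sigma2)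
  then show ?thesis
    by (simp add: EG_orbit_def EG_act_def carrier_Sigma2 T_mult_T_pow comp_def del: nat_pow_Suc)
qed

text \<open>The powers of \<open>T\<close> see only parity and the action of \<open>T\<close> adds 1
  to all exponents. The orbits agree iff the parity of \<open>ps ! m + m\<close> is constant in
  \<open>m\<close>.\<close>

lemma EG_orbit_eq_x_simplex_iff:
  assumes len: "length ps = Suc k"
  shows "EG_orbit Sigma2 (map (\<lambda>m. T [^]\<^bsub>Sigma2\<^esub> m) ps) = x_simplex k \<longleftrightarrow> parity_alternating ps"
proof -
  let ?f = "\<lambda>m::nat. T [^]\<^bsub>Sigma2\<^esub> m"
  have x: "x_simplex k = {map ?f [0..<Suc k], map (\<lambda>m. ?f (Suc m)) [0..<Suc k]}"
    unfolding x_simplex_def x_tilde_def by (rule EG_orbit_T_pow)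
  \<comment> \<open>The offset \<open>e\<close> is 0 or 1 in the forward direction and
    \<open>ps ! 0\<close> in the converse.\<close>
  have eq_iff: "map ?f ps = map (\<lambda>m. ?f (m + e)) [0..<Suc k] \<longleftrightarrow> (\<forall>m\<le>k. even (ps ! m + m + e))"
    for e
    using len by (auto simp: list_eq_iff_nth_eq T_pow_eq_iff less_Suc_eq_le simp del: upt_Suc)
  show ?thesis
  proof
    assume "EG_orbit Sigma2 (map ?f ps) = x_simplex k"
    then have "map ?f ps \<in> x_simplex k" unfolding EG_orbit_T_pow by blast
    then have "map ?f ps = map (\<lambda>m. ?f (m + 0)) [0..<Suc k]
        \<or> map ?f ps = map (\<lambda>m. ?f (m + 1)) [0..<Suc k]"
      unfolding x by (simp only: insert_iff empty_iff add_0_right Suc_eq_plus1 simp_thms)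
    then obtain e where par: "\<forall>m\<le>k. even (ps ! m + m + e)"
      unfolding eq_iff by blast
    show "parity_alternating ps"
      unfolding successively_conv_nth
    proof (intro allI impI)
      fix m assume "Suc m < length ps"
      with len have "even (ps ! m + m + e)" "even (ps ! Suc m + Suc m + e)"
        using par[rule_format, of m] par[rule_format, of "Suc m"] by linarith+
      then show "even (ps ! m) = odd (ps ! Suc m)"
        by (simp only: even_add even_Suc) blast
    qed
  next
    assume alt: "parity_alternating ps"
    have par: "even (ps ! m + m + ps ! 0)" if "m \<le> k" for m
      using that
    proof (induction m)
      case (Suc m)
      then have "even (ps ! m) = odd (ps ! Suc m)"
        using alt len by (simp add: successively_conv_nth)
      with Suc show ?case by simp blast
    qed simp
    have shift: "map (\<lambda>m. ?f (Suc m)) ps = map (\<lambda>m. ?f (Suc (m + ps ! 0))) [0..<Suc k]"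
      using par len
      by (auto simp: list_eq_iff_nth_eq T_pow_eq_iff less_Suc_eq_le add_ac
          simp del: upt_Suc nat_pow_Suc)
    have "map ?f ps = map (\<lambda>m. ?f (m + ps ! 0)) [0..<Suc k]"
      using par by (simp only: eq_iff) blast
    moreover have "?f (m + ps ! 0) = (if even (ps ! 0) then ?f m else ?f (Suc m))"
      "?f (Suc (m + ps ! 0)) = (if even (ps ! 0) then ?f (Suc m) else ?f m)" for m
      by (simp_all add: T_pow_eq_iff del: nat_pow_Suc)
    ultimately show "EG_orbit Sigma2 (map ?f ps) = x_simplex k"
      unfolding EG_orbit_T_pow x shift
      by (cases "even (ps ! 0)") (simp_all only: if_True if_False insert_commute simp_thms)
  qed
qed

lemma eval_face_x_simplex:
  assumes "sorted_wrt (<) ps" "set ps \<subseteq> {..N}"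
  shows "eval_face (BG Sigma2) i (t_cochain i) N (x_simplex N) (set ps)
    = (if length ps = Suc i \<and> parity_alternating ps then 1 else 0)"
proof -
  let ?f = "\<lambda>m::nat. T [^]\<^bsub>Sigma2\<^esub> m"
  have sd: "sorted ps" "distinct ps"
    using assms(1) by (simp_all add: strict_sorted_iff)
  have "set (nths [0..<Suc N] (set ps)) = set ps"
    using assms(2) by (force simp: set_nths less_Suc_eq_le nth_upt simp del: upt_Suc)
  then have "nths [0..<Suc N] (set ps) = ps"
    using sd by (intro sorted_distinct_set_unique sorted_nths) (auto simp del: upt_Suc)
  then have "nths (x_tilde N) (set ps) = map ?f ps"
    unfolding x_tilde_def by (simp add: nths_map del: upt_Suc)
  moreover have "x_tilde N \<in> simplices (EG Sigma2) N"
    by (auto simp: x_tilde_def T_pow carrier_Sigma2)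
  ultimately have "spanned_face (BG Sigma2) N (set ps) (x_simplex N) = EG_orbit Sigma2 (map ?f ps)"
    unfolding x_simplex_def using assms(2) by (simp add: spanned_face_BG del: EG_simps)
  then show ?thesis
    using sd by (auto simp: eval_face_def t_cochain_def dual_cochain_def distinct_card
        EG_orbit_eq_x_simplex_iff)
qed

section \<open>Comparison of the two cochains\<close>

lemma steenrod_product_x_simplex:
  assumes "n \<le> i + j"
  shows "steenrod_product (BG Sigma2) n i j (t_cochain i) (t_cochain j) (x_simplex (i + j - n))
    = of_nat (i choose n) * of_nat (j choose n)"
proof -
  define N where "N = i + j - n"
  have "x_simplex N \<in> simplices (BG Sigma2) N"
    using nondegenerate_BSigma2[of N] by (auto simp: nondegenerate_simplices_def)
  then have "steenrod_product (BG Sigma2) n i j (t_cochain i) (t_cochain j) (x_simplex N)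
      = (\<Sum>ks\<in>increasing_lists (Suc n) 0 N.
          eval_face (BG Sigma2) i (t_cochain i) N (x_simplex N) (steenrod_odd N ks) *
          eval_face (BG Sigma2) j (t_cochain j) N (x_simplex N) (steenrod_even N ks))"
    using assms by (simp add: steenrod_product_def increasing_lists_def N_def)
  also have "\<dots> = (\<Sum>ks\<in>increasing_lists (Suc n) 0 N.
        if parity_alternating ks \<and> length (alternate_intervals True N 0 ks) = Suc i
          \<and> length (alternate_intervals False N 0 ks) = Suc j then 1 else 0)"
  proof (intro sum.cong refl)
    fix ks assume "ks \<in> increasing_lists (Suc n) 0 N"
    then obtain k ks' where ks: "ks = k # ks'" "sorted_wrt (<) ks" "set ks \<subseteq> {..N}"
      by (cases ks) (auto simp: increasing_lists_def atLeast0AtMost)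
    \<comment> \<open>The first break may be 0, which \<open>alternate_intervals_sorted\<close> with
      \<open>s = 0\<close> excludes; it is applied to the tail, starting at
      \<open>k\<close>.\<close>
    have tl: "sorted_wrt (<) (alternate_intervals c N k ks')
        \<and> set (alternate_intervals c N k ks') \<subseteq> (if c then {k..N} else {k<..N})" for c
      using ks by (intro alternate_intervals_sorted) auto
    have "sorted_wrt (<) (alternate_intervals c N 0 ks)
        \<and> set (alternate_intervals c N 0 ks) \<subseteq> {..N}" for c
      using tl[of "\<not> c"] ks
      by (cases c) (fastforce simp: sorted_wrt_append simp del: upt_Suc)+
    moreover have "parity_alternating (alternate_intervals True N 0 ks)
        \<and> parity_alternating (alternate_intervals False N 0 ks) \<longleftrightarrow> parity_alternating ks"
      using parity_alternating_alternate_intervals[of k ks' N 0] ks by simp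
    ultimately show "eval_face (BG Sigma2) i (t_cochain i) N (x_simplex N) (steenrod_odd N ks) *
        eval_face (BG Sigma2) j (t_cochain j) N (x_simplex N) (steenrod_even N ks)
      = (if parity_alternating ks \<and> length (alternate_intervals True N 0 ks) = Suc i
          \<and> length (alternate_intervals False N 0 ks) = Suc j then 1 else 0)"
      unfolding steenrod_odd_even_eq by (auto simp: eval_face_x_simplex)
  qed
  also have "\<dots> = of_nat (i choose n) * of_nat (j choose n)"
    unfolding N_def by (rule sum_steenrod_faces[OF assms])
  finally show ?thesis unfolding N_def .
qed

lemma cochains_BSigma2_eqI:
  assumes "\<alpha> \<in> cochains (BG Sigma2) k" "\<beta> \<in> cochains (BG Sigma2) k"
    and "\<alpha> (x_simplex k) = \<beta> (x_simplex k)"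
  shows "\<alpha> = \<beta>"
proof
  fix u
  show "\<alpha> u = \<beta> u"
    using assms nondegenerate_BSigma2[of k]
    by (cases "u \<in> nondegenerate_simplices (BG Sigma2) k")
      (auto simp: cochains_def nondegenerate_simplices_def)
qed

theorem theorem0p1:
  fixes i j n :: nat
  shows "steenrod_product (BG Sigma2) n i j (t_cochain i) (t_cochain j)
           = (\<lambda>u. of_nat (i choose n) * of_nat (j choose n) * t_cochain (i + j - n) u)
         \<and> steenrod_product (BG Sigma2) n i j (t_cochain i) (t_cochain j)
             \<in> cochains (BG Sigma2) (i + j - n)"
    (is "?L = ?R \<and> ?L \<in> ?C")
proof
  show L: "?L \<in> ?C"
    by (intro simplicial_set.steenrod_product_in_cochains simplicial_set_BG t_cochain_in_cochains)
  have R: "?R \<in> ?C"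
    using t_cochain_in_cochains[of "i + j - n"] by (auto simp: cochains_def)
  show "?L = ?R"
  proof (cases "n \<le> i + j")
    case True
    moreover have "t_cochain k (x_simplex k) = 1" for k
      by (simp add: t_cochain_def dual_cochain_def)
    ultimately show ?thesis
      by (intro cochains_BSigma2_eqI[OF L R]) (simp add: steenrod_product_x_simplex)
  next
    case False
    \<comment> \<open>Here \<open>i + j - n\<close> truncates to 0, so the right side is a multiple
      of \<open>t_cochain 0\<close>; it vanishes because \<open>i choose n\<close> does.\<close>
    then have "i < n" by simp
    with False show ?thesis by (simp add: steenrod_product_def binomial_eq_0)
  qed
qed

end
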